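(* There exists a cap set $A \subseteq \mathbb{F}_3^{396}$ of size \[\binom{11}{7} \cdot 6^4 \cdot 12^4 \cdot 112^{62}.\]
   Context: A cap set is a set $A \subseteq \mathbb{F}_3^n$ such that the only solutions of $x+y+z=0$ with $x,y,z\in A$ are those with $x=y=z$. *)

theory Defs
  imports "HOL-Library.Numeral_Type" "HOL-Analysis.Finite_Cartesian_Product"
begin

text \<open>F_3 is the numeral type 3 (arithmetic mod 3); F_3^n is the vector type 3^'n.
A cap set: the only solutions of x+y+z=0 in A are those with x=y=z.\<close>

definition cap_set :: "'a::ab_group_add set \<Rightarrow> bool" where
  "cap_set A \<longleftrightarrow> (\<forall>x\<in>A. \<forall>y\<in>A. \<forall>z\<in>A. x + y + z = 0 \<longrightarrow> x = y \<and> y = z)"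

end

theory Submission
  imports Defs
begin

text \<open>
  This is Edel's extended product construction, iterated as in Tyrrell's work. Three caps \<open>A T0\<close>,
  \<open>A T1\<close>, \<open>A T2\<close> with suitable forbidden sums are combined along a set \<open>S\<close> of words over
  \<open>{T0, T1, T2}\<close>: the product of the caps selected by a word of \<open>S\<close> is a cap, and any three words of
  \<open>S\<close>, not all equal, have a coordinate at which the forbidden sums exclude a solution of
  \<open>x + y + z = 0\<close>. Starting from caps of sizes 12, 112, 112 in dimension 6, the six words of length 6
  with a single zero give caps of sizes \<open>6 * 12 * 112^5\<close>, \<open>112^6\<close>, \<open>112^6\<close> in dimension 36, which are
  again extendable; an admissible set of 330 words of length 11 with four zeros each then gives
  a cap of size \<open>330 * (6 * 12 * 112^5)^4 * (112^6)^7\<close> in dimension 396.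
\<close>

section \<open>Extended products of extendable triples of caps\<close>

datatype trit = T0 | T1 | T2

text \<open>Up to order these are the triples (\<open>T0\<close>, \<open>T0\<close>, nonzero) and
  (\<open>T0\<close>, \<open>T1\<close>, \<open>T2\<close>), that is, the sums which
  \<open>extendable\<close> forbids to vanish.\<close>

definition separating :: "trit \<Rightarrow> trit \<Rightarrow> trit \<Rightarrow> bool" where
  "separating a b c \<longleftrightarrow> a = T0 \<and> b \<noteq> c \<or> b = T0 \<and> a \<noteq> c \<or> c = T0 \<and> a \<noteq> b"

definition admissible :: "(trit ^ 'n) set \<Rightarrow> bool" where
  "admissible S \<longleftrightarrow> (\<forall>s\<in>S. \<forall>t\<in>S. \<forall>u\<in>S.
     (\<exists>k. separating (s $ k) (t $ k) (u $ k)) \<or> s = t \<and> t = u)"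

definition extendable :: "(trit \<Rightarrow> 'a::ab_group_add set) \<Rightarrow> bool" where
  "extendable A \<longleftrightarrow> (\<forall>c. cap_set (A c)) \<and>
     (\<forall>x\<in>A T0. \<forall>y\<in>A T0. \<forall>z\<in>A T1 \<union> A T2. x + y + z \<noteq> 0) \<and>
     (\<forall>x\<in>A T0. \<forall>y\<in>A T1. \<forall>z\<in>A T2. x + y + z \<noteq> 0)"

lemma extendable_sum_nonzero:
  assumes "extendable A" "separating a b c" "x \<in> A a" "y \<in> A b" "z \<in> A c"
  shows "x + y + z \<noteq> 0"
proof -
  have *: "p + q + r \<noteq> 0" if "p \<in> A T0" "q \<in> A T0" "r \<in> A T1 \<union> A T2" for p q r
    using assms(1) that unfolding extendable_def by blast
  have **: "p + q + r \<noteq> 0" if "p \<in> A T0" "q \<in> A T1" "r \<in> A T2" for p q r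
    using assms(1) that unfolding extendable_def by blast
  show ?thesis
    using assms(2-) *[of x y z] *[of x z y] *[of y z x]
      **[of x y z] **[of x z y] **[of y x z] **[of y z x] **[of z x y] **[of z y x]
    by (cases a; cases b; cases c) (simp_all add: separating_def ac_simps)
qed

definition ext_prod :: "(trit \<Rightarrow> 'a set) \<Rightarrow> (trit ^ 'n) set \<Rightarrow> ('a ^ 'n) set" where
  "ext_prod A S = {x. \<exists>s\<in>S. \<forall>k. x $ k \<in> A (s $ k)}"

lemma ext_prod_sum_nonzero:
  assumes "extendable A"
    and "\<And>s t u. s \<in> S \<Longrightarrow> t \<in> T \<Longrightarrow> u \<in> U \<Longrightarrow> \<exists>k. separating (s $ k) (t $ k) (u $ k)"
    and "x \<in> ext_prod A S" "y \<in> ext_prod A T" "z \<in> ext_prod A U"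
  shows "x + y + z \<noteq> 0"
proof -
  obtain s t u where "s \<in> S" "t \<in> T" "u \<in> U"
    and mem: "\<And>k. x $ k \<in> A (s $ k)" "\<And>k. y $ k \<in> A (t $ k)" "\<And>k. z $ k \<in> A (u $ k)"
    using assms(3-5) unfolding ext_prod_def by blast
  then obtain k where "separating (s $ k) (t $ k) (u $ k)"
    using assms(2) by blast
  then have "x $ k + y $ k + z $ k \<noteq> 0"
    using extendable_sum_nonzero[OF assms(1)] mem by blast
  then show ?thesis
    by (metis vector_add_component zero_index)
qed

text \<open>A solution of \<open>x + y + z = 0\<close> is one in every coordinate, so no coordinate
  separates the three words and admissibility makes them equal. Each coordinate then takes place
  inside a single cap.\<close>

lemma cap_set_ext_prod:
  assumes "extendable A" "admissible S"
  shows "cap_set (ext_prod A S)"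
  unfolding cap_set_def
proof (intro ballI impI)
  fix x y z
  assume "x \<in> ext_prod A S" "y \<in> ext_prod A S" "z \<in> ext_prod A S" and sum: "x + y + z = 0"
  then obtain s t u where stu: "s \<in> S" "t \<in> S" "u \<in> S"
    and mem: "\<And>k. x $ k \<in> A (s $ k)" "\<And>k. y $ k \<in> A (t $ k)" "\<And>k. z $ k \<in> A (u $ k)"
    unfolding ext_prod_def by blast
  have sum_k: "x $ k + y $ k + z $ k = 0" for k
    using sum by (metis vector_add_component zero_index)
  have "\<not> separating (s $ k) (t $ k) (u $ k)" for k
    using extendable_sum_nonzero[OF assms(1)] mem sum_k by blast
  then have "s = t" "t = u"
    using assms(2) stu unfolding admissible_def by blast+
  then have "x $ k = y $ k \<and> y $ k = z $ k" for k
    using assms(1) mem sum_k unfolding extendable_def cap_set_def by blast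
  then show "x = y \<and> y = z"
    by (simp add: vec_eq_iff)
qed

lemma card_vec_Pi:
  "card {x :: 'a ^ 'n. \<forall>k. x $ k \<in> B k} = (\<Prod>k\<in>UNIV. card (B k))"
proof -
  have "bij_betw vec_nth {x :: 'a ^ 'n. \<forall>k. x $ k \<in> B k} (Pi\<^sub>E UNIV B)"
    by (rule bij_betw_byWitness[where f' = vec_lambda]) auto
  then have "card {x :: 'a ^ 'n. \<forall>k. x $ k \<in> B k} = card (Pi\<^sub>E UNIV B)"
    by (rule bij_betw_same_card)
  then show ?thesis
    by (simp add: card_PiE)
qed

text \<open>Distinct words give disjoint products: admissibility of \<open>s\<close>,
  \<open>s\<close>, \<open>t\<close> yields a separating coordinate, where a common entry would have
  nonzero triple, against characteristic 3.\<close>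

lemma card_ext_prod:
  fixes A :: "trit \<Rightarrow> 'a::{ab_group_add, finite} set" and S :: "(trit ^ 'n) set"
  assumes "extendable A" "admissible S" "finite S" and char3: "\<And>x::'a. x + x + x = 0"
  shows "card (ext_prod A S) = (\<Sum>s\<in>S. \<Prod>k\<in>UNIV. card (A (s $ k)))"
proof -
  define F where "F s = {x :: 'a ^ 'n. \<forall>k. x $ k \<in> A (s $ k)}" for s
  have disj: "F s \<inter> F t = {}" if "s \<in> S" "t \<in> S" "s \<noteq> t" for s t
  proof -
    obtain k where "separating (s $ k) (s $ k) (t $ k)"
      using assms(2) \<open>s \<in> S\<close> \<open>t \<in> S\<close> \<open>s \<noteq> t\<close> unfolding admissible_def by blast
    then have "A (s $ k) \<inter> A (t $ k) = {}"
      using extendable_sum_nonzero[OF assms(1)] char3 by blast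
    then show ?thesis
      unfolding F_def by blast
  qed
  have "ext_prod A S = (\<Union>s\<in>S. F s)"
    unfolding ext_prod_def F_def by blast
  then have "card (ext_prod A S) = (\<Sum>s\<in>S. card (F s))"
    using assms(3) disj by (simp add: card_UN_disjoint)
  then show ?thesis
    by (simp add: F_def card_vec_Pi)
qed

section \<open>Words with a single zero\<close>

text \<open>
  One word for each position of the zero. Whether the entry is T1 or T2 is a tournament on the
  positions, so among three of them some position sees both T1 and T2.
\<close>

definition one_zero :: "'n::{finite, linorder} \<Rightarrow> (trit, 'n) vec" where
  "one_zero j = (\<chi> i. if i = j then T0 else if i < j then T1 else T2)"

lemma admissible_one_zero: "admissible (range one_zero)"
  unfolding admissible_def
proof clarify
  fix i j l :: 'a
  assume ne: "\<not> (one_zero i = one_zero j \<and> one_zero j = one_zero l)"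
  let ?sep = "\<lambda>k. separating (one_zero i $ k) (one_zero j $ k) (one_zero l $ k)"
  \<comment> \<open>For three distinct positions the middle one sees \<open>T0\<close>,
    \<open>T1\<close> and \<open>T2\<close>; if exactly two coincide, the repeated one sees
    \<open>T0\<close> twice and a nonzero entry.\<close>
  have "?sep i \<or> ?sep j \<or> ?sep l"
    using ne by (cases i j rule: linorder_cases; cases j l rule: linorder_cases; cases i l rule: linorder_cases)
      (auto simp: separating_def one_zero_def)
  then show "\<exists>k. ?sep k" by blast
qed

fun one_zero_layers :: "trit \<Rightarrow> (trit, 'n::{finite, linorder}) vec set" where
  "one_zero_layers T0 = range one_zero"
| "one_zero_layers c = {vec c}"

lemma extendable_one_zero:
  assumes "extendable A"
  shows "extendable (\<lambda>c. ext_prod A (one_zero_layers c :: (trit, 'n::{finite, linorder}) vec set))"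
proof -
  have "cap_set (ext_prod A (one_zero_layers c :: (trit, 'n) vec set))" for c
    by (rule cap_set_ext_prod[OF assms], cases c)
      (auto simp: admissible_one_zero, auto simp: admissible_def)
  moreover have "x + y + z \<noteq> 0"
    if "x \<in> ext_prod A (one_zero_layers T0)" "y \<in> ext_prod A (one_zero_layers T0)"
      "z \<in> ext_prod A (one_zero_layers c)" "c \<noteq> T0" for x y z :: "('a, 'n) vec" and c
  proof (rule ext_prod_sum_nonzero[OF assms _ that(1-3)])
    fix s t u :: "(trit, 'n) vec"
    assume "s \<in> one_zero_layers T0" "t \<in> one_zero_layers T0" "u \<in> one_zero_layers c"
    then obtain i j where ij: "s = one_zero i" "t = one_zero j" "u = vec c"
      using \<open>c \<noteq> T0\<close> by (cases c) auto
    \<comment> \<open>For distinct \<open>i\<close> and \<open>j\<close>, the entries opposite the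
      two zeros are \<open>T1\<close> and \<open>T2\<close> in some order, and one of them differs
      from \<open>c\<close>. For \<open>i = j\<close> two zeros meet the nonzero
      \<open>c\<close>.\<close>
    then have "separating (s $ i) (t $ i) (u $ i) \<or> separating (s $ j) (t $ j) (u $ j)"
      using \<open>c \<noteq> T0\<close> by (cases i j rule: linorder_cases; cases c) (auto simp: separating_def one_zero_def)
    then show "\<exists>k. separating (s $ k) (t $ k) (u $ k)" by blast
  qed
  moreover have "x + y + z \<noteq> 0"
    if "x \<in> ext_prod A (one_zero_layers T0)" "y \<in> ext_prod A (one_zero_layers T1)"
      "z \<in> ext_prod A (one_zero_layers T2)" for x y z :: "('a, 'n) vec"
    by (rule ext_prod_sum_nonzero[OF assms _ that]) (auto simp: separating_def one_zero_def)
  ultimately show ?thesis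
    unfolding extendable_def by blast
qed

lemma card_one_zero:
  fixes A :: "trit \<Rightarrow> 'a::{ab_group_add, finite} set"
  assumes "extendable A" and char3: "\<And>x::'a. x + x + x = 0"
    and "card (A T1) = m" "card (A T2) = m"
  shows "card (ext_prod A (one_zero_layers T0 :: (trit, 'n::{finite, linorder}) vec set)) =
      CARD('n) * (card (A T0) * m ^ (CARD('n) - 1))"
    and "c \<noteq> T0 \<Longrightarrow> card (ext_prod A (one_zero_layers c :: (trit, 'n) vec set)) = m ^ CARD('n)"
proof -
  have inj: "inj (one_zero :: 'n \<Rightarrow> _)"
  proof
    fix i j :: 'n
    assume "one_zero i = one_zero j"
    then have "one_zero i $ i = one_zero j $ i" by simp
    then show "i = j" by (auto simp: one_zero_def split: if_splits)
  qed
  have "(\<Prod>k\<in>UNIV. card (A (one_zero j $ k))) = card (A T0) * m ^ (CARD('n) - 1)" for j :: 'n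
  proof -
    have "(\<Prod>k\<in>UNIV - {j}. card (A (one_zero j $ k))) = (\<Prod>k\<in>UNIV - {j}. m)"
      using assms(3,4) by (intro prod.cong) (auto simp: one_zero_def)
    then show ?thesis
      by (simp add: prod.remove[of _ j] one_zero_def)
  qed
  then show "card (ext_prod A (one_zero_layers T0 :: (trit, 'n) vec set)) =
      CARD('n) * (card (A T0) * m ^ (CARD('n) - 1))"
    by (simp add: card_ext_prod assms admissible_one_zero sum.reindex[OF inj])
  show "card (ext_prod A (one_zero_layers c :: (trit, 'n) vec set)) = m ^ CARD('n)" if "c \<noteq> T0"
    using that assms(3,4)
    by (cases c) (simp_all add: card_ext_prod assms(1,2) admissible_def)
qed

section \<open>Words as lists, and flattening of nested vectors\<close>

text \<open>An arbitrary numbering of the coordinates, which lets words be computed with as lists.\<close>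

definition idx :: "'n::finite \<Rightarrow> nat" where
  "idx = (SOME h. bij_betw h UNIV {0..<CARD('n)})"

lemma bij_betw_idx: "bij_betw (idx :: 'n::finite \<Rightarrow> nat) UNIV {0..<CARD('n)}"
proof -
  have "\<exists>h :: 'n \<Rightarrow> nat. bij_betw h UNIV {0..<CARD('n)}"
    by (rule ex_bij_betw_finite_nat) simp
  then show ?thesis
    unfolding idx_def by (rule someI_ex)
qed

definition vec_of_list :: "'a list \<Rightarrow> 'a ^ 'n" where
  "vec_of_list w = (\<chi> k. w ! idx k)"

lemma all_vec_of_list:
  "(\<forall>k :: 'n::finite. P (idx k)) \<longleftrightarrow> (\<forall>i < CARD('n). P i)"
proof -
  have "range (idx :: 'n \<Rightarrow> nat) = {0..<CARD('n)}"
    using bij_betw_idx by (rule bij_betw_imp_surj_on)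
  then show ?thesis
    by (metis (no_types, lifting) UNIV_I atLeast0LessThan image_iff lessThan_iff)
qed

lemma vec_of_list_eq_iff:
  assumes "length v = CARD('n)" "length w = CARD('n)"
  shows "(vec_of_list v :: 'a ^ 'n) = vec_of_list w \<longleftrightarrow> v = w"
  using assms all_vec_of_list[where 'n = 'n, of "\<lambda>i. v ! i = w ! i"]
  by (simp add: vec_of_list_def vec_eq_iff list_eq_iff_nth_eq)

lemma prod_vec_of_list:
  fixes f :: "'a \<Rightarrow> 'b::comm_monoid_mult"
  assumes "length w = CARD('n)"
  shows "(\<Prod>k\<in>UNIV. f ((vec_of_list w :: 'a ^ 'n) $ k)) = prod_list (map f w)"
proof -
  have "(\<Prod>k\<in>UNIV. f ((vec_of_list w :: 'a ^ 'n) $ k)) = (\<Prod>i = 0..<CARD('n). f (w ! i))"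
    using prod.reindex_bij_betw[OF bij_betw_idx[where 'n = 'n], of "\<lambda>i. f (w ! i)"]
    by (simp add: vec_of_list_def)
  also have "\<dots> = prod_list (map f w)"
    using assms by (simp add: prod.list_conv_set_nth)
  finally show ?thesis .
qed

lemma cap_set_image:
  assumes "cap_set A" "inj f" "\<And>x y. f (x + y) = f x + f y"
  shows "cap_set (f ` A)"
proof -
  have "f 0 = 0"
    by (metis add_cancel_right_right assms(3))
  then show ?thesis
    using assms unfolding cap_set_def by (auto simp: inj_def) (metis assms(3))+
qed

text \<open>Flattens the nested vectors of the iterated product. Addition is coordinatewise, so any
  bijection between the index types serves.\<close>

lemma ex_additive_inj:
  assumes "CARD('k::finite) = CARD('l) * CARD('m) * CARD('n)"
  shows "\<exists>f :: (('a::ab_group_add ^ 'l::finite) ^ 'm::finite) ^ 'n::finite \<Rightarrow> 'a ^ 'k.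
    inj f \<and> (\<forall>x y. f (x + y) = f x + f y)"
proof -
  have "CARD('k) = CARD('n \<times> 'm \<times> 'l)"
    using assms by simp
  then obtain g :: "'k \<Rightarrow> 'n \<times> 'm \<times> 'l" where g: "bij g"
    using finite_same_card_bij[of "UNIV :: 'k set" "UNIV :: ('n \<times> 'm \<times> 'l) set"] by auto
  define f :: "(('a ^ 'l) ^ 'm) ^ 'n \<Rightarrow> 'a ^ 'k"
    where "f x = (\<chi> i. case g i of (a, b, c) \<Rightarrow> x $ a $ b $ c)" for x
  have "f x $ inv g (a, b, c) = x $ a $ b $ c" for x a b c
    by (simp add: f_def bij_is_surj[OF g] surj_f_inv_f)
  then have "inj f"
    by (metis (no_types, lifting) injI vec_eq_iff)
  moreover have "f (x + y) = f x + f y" for x y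
    by (simp add: f_def vec_eq_iff split: prod.split)
  ultimately show ?thesis by blast
qed

section \<open>Tries and a pruned check of admissibility\<close>

datatype trie = Empty | Leaf | Node trie trie trie

fun trie_of :: "nat \<Rightarrow> trit list list \<Rightarrow> trie" where
  "trie_of n [] = Empty"
| "trie_of 0 (w # ws) = Leaf"
| "trie_of (Suc n) (w # ws) = Node
     (trie_of n (map tl (filter (\<lambda>v. hd v = T0) (w # ws))))
     (trie_of n (map tl (filter (\<lambda>v. hd v = T1) (w # ws))))
     (trie_of n (map tl (filter (\<lambda>v. hd v = T2) (w # ws))))"

fun in_trie :: "trit list \<Rightarrow> trie \<Rightarrow> bool" where
  "in_trie [] Leaf = True"
| "in_trie (c # w) (Node t0 t1 t2) = in_trie w (case c of T0 \<Rightarrow> t0 | T1 \<Rightarrow> t1 | T2 \<Rightarrow> t2)"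
| "in_trie _ _ = False"

lemma in_trie_Empty [simp]: "\<not> in_trie w Empty"
  by (cases w) simp_all

lemma in_trie_Leaf [simp]: "in_trie w Leaf \<longleftrightarrow> w = []"
  by (cases w) simp_all

lemma in_trie_NodeE:
  assumes "in_trie w (Node t0 t1 t2)"
  obtains c v where "w = c # v"
  using assms by (cases w) simp_all

text \<open>Carries checks on tries over to word lists: what holds for all words of the trie holds
  for those of the list.\<close>

lemma in_trie_of:
  assumes "w \<in> set ws" "length w = n"
  shows "in_trie w (trie_of n ws)"
  using assms
proof (induction n ws arbitrary: w rule: trie_of.induct)
  case (3 n v ws)
  then obtain c w' where w: "w = c # w'" "length w' = n"
    by (cases w) auto
  then have "w' \<in> set (map tl (filter (\<lambda>v. hd v = c) (v # ws)))"
    using 3(4) by force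
  then show ?case
    using 3(1-3) w by (cases c) (simp_all)
qed auto

fun separated :: "trit list \<Rightarrow> trit list \<Rightarrow> trit list \<Rightarrow> bool" where
  "separated (a # x) (b # y) (c # z) \<longleftrightarrow> separating a b c \<or> separated x y z"
| "separated _ _ _ \<longleftrightarrow> False"

lemma separated_nth:
  "separated x y z \<Longrightarrow> \<exists>i < length x. separating (x ! i) (y ! i) (z ! i)"
  by (induction x y z rule: separated.induct) force+

lemma separating_commute:
  "separating a b c = separating b a c" "separating a b c = separating a c b"
  by (auto simp: separating_def)

lemma separated_commute: "separated x y z = separated y x z" "separated x y z = separated x z y"
  by (induction x y z rule: separated.induct) (auto simp: separating_commute)

text \<open>
  Triples of words are enumerated by descending the tries in parallel; a branch is abandoned at the
  first separating coordinate. The triples handled by \<open>separated2 t u\<close> have two words in \<open>t\<close> and one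
  in \<open>u\<close>, in any order, so every unordered triple is visited only once.
\<close>

fun separated3 :: "trie \<Rightarrow> trie \<Rightarrow> trie \<Rightarrow> bool" where
  "separated3 Empty u v = True"
| "separated3 t Empty v = True"
| "separated3 t u Empty = True"
| "separated3 (Node t0 t1 t2) (Node u0 u1 u2) (Node v0 v1 v2) \<longleftrightarrow>
    separated3 t0 u0 v0 \<and> separated3 t0 u1 v1 \<and> separated3 t0 u2 v2 \<and>
    separated3 t1 u0 v1 \<and> separated3 t1 u1 v0 \<and> separated3 t1 u1 v1 \<and>
    separated3 t1 u1 v2 \<and> separated3 t1 u2 v1 \<and> separated3 t1 u2 v2 \<and>
    separated3 t2 u0 v2 \<and> separated3 t2 u2 v0 \<and> separated3 t2 u2 v2 \<and>
    separated3 t2 u2 v1 \<and> separated3 t2 u1 v2 \<and> separated3 t2 u1 v1"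
| "separated3 _ _ _ = False"

fun separated2 :: "trie \<Rightarrow> trie \<Rightarrow> bool" where
  "separated2 Empty u = True"
| "separated2 t Empty = True"
| "separated2 (Node t0 t1 t2) (Node u0 u1 u2) \<longleftrightarrow>
    separated2 t0 u0 \<and> separated2 t1 u0 \<and> separated2 t2 u0 \<and>
    separated2 t1 u1 \<and> separated2 t1 u2 \<and> separated2 t2 u1 \<and> separated2 t2 u2 \<and>
    separated3 t0 t1 u1 \<and> separated3 t0 t2 u2 \<and> separated3 t1 t2 u1 \<and> separated3 t1 t2 u2"
| "separated2 _ _ = False"

text \<open>A leaf passes here because words that descend together to it are equal. In the calls to
  \<open>separated2\<close> and \<open>separated3\<close> the words have already diverged, so leaves
  meeting there are a failure.\<close>

fun separated1 :: "trie \<Rightarrow> bool" where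
  "separated1 (Node t0 t1 t2) \<longleftrightarrow> separated1 t0 \<and> separated1 t1 \<and> separated1 t2 \<and>
     separated2 t1 t0 \<and> separated2 t2 t0 \<and> separated2 t1 t2 \<and> separated2 t2 t1"
| "separated1 _ = True"

lemma separated3:
  assumes "separated3 t u v" "in_trie x t" "in_trie y u" "in_trie z v"
  shows "separated x y z"
  using assms
proof (induction x arbitrary: y z t u v)
  case Nil
  then show ?case by (cases t; cases u; cases v) auto
next
  case (Cons a x)
  obtain t0 t1 t2 where t: "t = Node t0 t1 t2"
    using Cons.prems(2) by (cases t) auto
  obtain u0 u1 u2 where u: "u = Node u0 u1 u2"
    using Cons.prems t by (cases u; cases v) auto
  obtain v0 v1 v2 where v: "v = Node v0 v1 v2"
    using Cons.prems t u by (cases v) auto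
  obtain b y' c z' where yz: "y = b # y'" "z = c # z'"
    using Cons.prems u v in_trie_NodeE by metis
  show ?case
    using Cons.prems unfolding t u v yz
    by (cases a; cases b; cases c; simp add: separating_def) (blast intro: Cons.IH)+
qed

lemma separated2:
  assumes "separated2 t u" "in_trie x t" "in_trie y t" "in_trie z u"
  shows "separated x y z"
  using assms
proof (induction x arbitrary: y z t u)
  case Nil
  then show ?case by (cases t; cases u) auto
next
  case (Cons a x)
  obtain t0 t1 t2 where t: "t = Node t0 t1 t2"
    using Cons.prems(2) by (cases t) auto
  obtain u0 u1 u2 where u: "u = Node u0 u1 u2"
    using Cons.prems t by (cases u) auto
  obtain b y' c z' where yz: "y = b # y'" "z = c # z'"
    using Cons.prems t u in_trie_NodeE by metis
  \<comment> \<open>The check lists the subtries of the two words from \<open>t\<close> in one order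
    only, so \<open>x\<close> and \<open>y'\<close> may have to trade places.\<close>
  have swap: "separated x y' z'"
    if "separated3 t u v" "in_trie y' t" "in_trie x u" "in_trie z' v" for t u v
    using separated3[OF that] separated_commute by blast
  show ?case
    using Cons.prems unfolding t u yz
    by (cases a; cases b; cases c; simp add: separating_def) (blast intro: Cons.IH separated3 swap)+
qed

lemma separated1:
  assumes "separated1 t" "in_trie x t" "in_trie y t" "in_trie z t"
  shows "separated x y z \<or> x = y \<and> y = z"
  using assms
proof (induction x arbitrary: y z t)
  case Nil
  then show ?case by (cases t) auto
next
  case (Cons a x)
  obtain t0 t1 t2 where t: "t = Node t0 t1 t2"
    using Cons.prems(2) by (cases t) auto
  obtain b y' c z' where yz: "y = b # y'" "z = c # z'"
    using Cons.prems t in_trie_NodeE by metis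
  have swap: "separated x y' z'"
    if "separated2 t u" "in_trie y' t" "in_trie z' t" "in_trie x u" for t u
    using separated2[OF that] separated_commute by blast
  have swap': "separated x y' z'"
    if "separated2 t u" "in_trie x t" "in_trie z' t" "in_trie y' u" for t u
    using separated2[OF that] separated_commute by blast
  show ?case
    using Cons.prems unfolding t yz
    by (cases a; cases b; cases c; simp add: separating_def)
      (blast dest: Cons.IH intro: separated2 swap swap')+
qed

section \<open>The three caps in dimension 6\<close>

text \<open>
  The ten blocks form a 2-(6,3,2) design; their complements are the ten other 3-subsets. Each of the two 112-caps consists of the
  \<open>10 * 8\<close> words supported on a block (or on the complement of one) and the 32 words without zeros
  having an even number of entries 2; the 12-cap consists of the words of weight one.
\<close>

definition blocks :: "bool list list" where
  "blocks = [True # rotate i [True, True, False, False, False]. i \<leftarrow> [0..<5]] @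
     [False # rotate i [True, True, False, True, False]. i \<leftarrow> [0..<5]]"

fun signings :: "bool list \<Rightarrow> trit list list" where
  "signings [] = [[]]"
| "signings (b # bs) =
    (if b then map ((#) T1) (signings bs) @ map ((#) T2) (signings bs) else map ((#) T0) (signings bs))"

fun parity_words :: "nat \<Rightarrow> bool \<Rightarrow> trit list list" where
  "parity_words 0 e = (if e then [[]] else [])"
| "parity_words (Suc n) e = map ((#) T1) (parity_words n e) @ map ((#) T2) (parity_words n (\<not> e))"

fun cap_words :: "trit \<Rightarrow> trit list list" where
  "cap_words T0 = concat (map signings [rotate i [True, False, False, False, False, False]. i \<leftarrow> [0..<6]])"
| "cap_words T1 = concat (map signings blocks) @ parity_words 6 True"
| "cap_words T2 = concat (map (signings \<circ> map Not) blocks) @ parity_words 6 True"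

lemma length_cap_words:
  "length (cap_words T0) = 12" "length (cap_words T1) = 112" "length (cap_words T2) = 112"
  by code_simp+

lemma cap_words_length: "w \<in> set (cap_words c) \<Longrightarrow> length w = 6"
proof -
  have "\<forall>w\<in>set (cap_words T0). length w = 6" "\<forall>w\<in>set (cap_words T1). length w = 6"
    "\<forall>w\<in>set (cap_words T2). length w = 6"
    by code_simp+
  then show "w \<in> set (cap_words c) \<Longrightarrow> length w = 6"
    by (cases c) blast+
qed

lemma distinct_cap_words: "distinct (cap_words c)"
proof -
  have "distinct (cap_words T0)" "distinct (cap_words T1)" "distinct (cap_words T2)"
    by code_simp+
  then show ?thesis
    by (cases c) blast+
qed

text \<open>Under \<open>T0 = 0\<close>, \<open>T1 = 1\<close>, \<open>T2 = 2\<close> these are the triples with sum 0 in \<open>F_3\<close>.\<close>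

definition line :: "trit \<Rightarrow> trit \<Rightarrow> trit \<Rightarrow> bool" where
  "line a b c \<longleftrightarrow> a = b \<and> b = c \<or> a \<noteq> b \<and> b \<noteq> c \<and> a \<noteq> c"

fun lines :: "trit list \<Rightarrow> trit list \<Rightarrow> trit list \<Rightarrow> bool" where
  "lines (a # x) (b # y) (c # z) \<longleftrightarrow> line a b c \<and> lines x y z"
| "lines _ _ _ \<longleftrightarrow> True"

lemma line_commute: "line a b c = line b a c" "line a b c = line a c b"
  by (auto simp: line_def)

lemma lines_commute: "lines x y z = lines y x z" "lines x y z = lines x z y"
  by (induction x y z rule: lines.induct) (auto simp: line_commute)

lemma lines_nth:
  "\<lbrakk>\<And>i. i < length x \<Longrightarrow> line (x ! i) (y ! i) (z ! i); length y = length x; length z = length x\<rbrakk> \<Longrightarrow>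
   lines x y z"
proof (induction x y z rule: lines.induct)
  case (1 a x b y c z)
  from 1(2)[of 0] 1(2)[of "Suc _"] 1(1,3,4) show ?case by auto
qed auto

text \<open>The same parallel descent as in \<open>separated3\<close>, now following the nine head
  triples with sum 0 in F_3 and dropping all others.\<close>

fun line_free3 :: "trie \<Rightarrow> trie \<Rightarrow> trie \<Rightarrow> bool" where
  "line_free3 Empty u v = True"
| "line_free3 t Empty v = True"
| "line_free3 t u Empty = True"
| "line_free3 (Node t0 t1 t2) (Node u0 u1 u2) (Node v0 v1 v2) \<longleftrightarrow>
    line_free3 t0 u0 v0 \<and> line_free3 t1 u1 v1 \<and> line_free3 t2 u2 v2 \<and>
    line_free3 t0 u1 v2 \<and> line_free3 t0 u2 v1 \<and> line_free3 t1 u0 v2 \<and>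
    line_free3 t1 u2 v0 \<and> line_free3 t2 u0 v1 \<and> line_free3 t2 u1 v0"
| "line_free3 _ _ _ = False"

text \<open>The heads of a line are all equal or all different. By symmetry of \<open>lines\<close>,
  one order of the three branches covers the second case.\<close>

fun line_free :: "trie \<Rightarrow> bool" where
  "line_free (Node t0 t1 t2) \<longleftrightarrow>
     line_free t0 \<and> line_free t1 \<and> line_free t2 \<and> line_free3 t0 t1 t2"
| "line_free _ = True"

lemma line_free3:
  assumes "line_free3 t u v" "in_trie x t" "in_trie y u" "in_trie z v"
  shows "\<not> lines x y z"
  using assms
proof (induction x arbitrary: y z t u v)
  case Nil
  then show ?case by (cases t; cases u; cases v) auto
next
  case (Cons a x)
  obtain t0 t1 t2 where t: "t = Node t0 t1 t2"
    using Cons.prems(2) by (cases t) auto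
  obtain u0 u1 u2 where u: "u = Node u0 u1 u2"
    using Cons.prems t by (cases u; cases v) auto
  obtain v0 v1 v2 where v: "v = Node v0 v1 v2"
    using Cons.prems t u by (cases v) auto
  obtain b y' c z' where yz: "y = b # y'" "z = c # z'"
    using Cons.prems u v in_trie_NodeE by metis
  show ?case
    using Cons.prems unfolding t u v yz
    by (cases a; cases b; cases c; simp add: line_def) (blast dest: Cons.IH)+
qed

lemma line_free:
  assumes "line_free t" "in_trie x t" "in_trie y t" "in_trie z t" "lines x y z"
  shows "x = y \<and> y = z"
  using assms
proof (induction x arbitrary: y z t)
  case Nil
  then show ?case by (cases t) auto
next
  case (Cons a x)
  obtain t0 t1 t2 where t: "t = Node t0 t1 t2"
    using Cons.prems(2) by (cases t) auto
  obtain b y' c z' where yz: "y = b # y'" "z = c # z'"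
    using Cons.prems t in_trie_NodeE by metis
  have "\<not> lines p q r" if "in_trie p t0" "in_trie q t1" "in_trie r t2" for p q r
    using line_free3[of t0 t1 t2] Cons.prems(1) t that by simp
  then have perms: "\<not> lines p q r" "\<not> lines p r q" "\<not> lines q p r"
      "\<not> lines q r p" "\<not> lines r p q" "\<not> lines r q p"
    if "in_trie p t0" "in_trie q t1" "in_trie r t2" for p q r
    using lines_commute that by blast+
  show ?case
    using Cons.prems unfolding t yz
    by (cases a; cases b; cases c; simp add: line_def) (blast dest: Cons.IH perms)+
qed

abbreviation cap_trie :: "trit \<Rightarrow> trie" where
  "cap_trie c \<equiv> trie_of 6 (cap_words c)"

text \<open>One evaluation for each clause of \<open>extendable\<close>; the cap property is
  computed here rather than derived from the design.\<close>

lemma line_free_cap_words: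
  "line_free (cap_trie T0)" "line_free (cap_trie T1)" "line_free (cap_trie T2)"
  "line_free3 (cap_trie T0) (cap_trie T0) (cap_trie T1)"
  "line_free3 (cap_trie T0) (cap_trie T0) (cap_trie T2)"
  "line_free3 (cap_trie T0) (cap_trie T1) (cap_trie T2)"
  by code_simp+

fun val :: "trit \<Rightarrow> 3" where "val T0 = 0" | "val T1 = 1" | "val T2 = 2"

lemma val_eq_iff: "val a = val b \<longleftrightarrow> a = b"
  by (cases a; cases b) simp_all

lemma val_sum_eq_0_iff: "val a + val b + val c = 0 \<longleftrightarrow> line a b c"
  by (cases a; cases b; cases c) (simp_all add: line_def)

definition vec3 :: "trit list \<Rightarrow> 3 ^ 6" where
  "vec3 w = vec_of_list (map val w)"

lemma vec3_eq_iff: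
  assumes "length v = 6" "length w = 6"
  shows "vec3 v = vec3 w \<longleftrightarrow> v = w"
  using assms by (simp add: vec3_def vec_of_list_eq_iff inj_map_eq_map inj_def val_eq_iff)

lemma vec3_sum_eq_0:
  assumes "length x = 6" "length y = 6" "length z = 6" "vec3 x + vec3 y + vec3 z = 0"
  shows "lines x y z"
proof -
  have "\<forall>i < CARD(6). (map val x ! i + map val y ! i + map val z ! i) = 0"
    using assms(4) all_vec_of_list[where 'n = 6, of "\<lambda>i. map val x ! i + map val y ! i + map val z ! i = 0"]
    by (simp add: vec3_def vec_of_list_def vec_eq_iff)
  then show ?thesis
    using assms(1-3) by (auto intro!: lines_nth simp: val_sum_eq_0_iff)
qed

definition cap6 :: "trit \<Rightarrow> (3 ^ 6) set" where
  "cap6 c = vec3 ` set (cap_words c)"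

lemma card_cap6: "card (cap6 c) = length (cap_words c)"
proof -
  have "inj_on vec3 (set (cap_words c))"
    by (auto intro!: inj_onI simp: vec3_eq_iff cap_words_length)
  then show ?thesis
    by (simp add: cap6_def card_image distinct_card distinct_cap_words)
qed

lemma cap6_sum_zeroE:
  assumes "x \<in> cap6 a" "y \<in> cap6 b" "z \<in> cap6 c" "x + y + z = 0"
  obtains u v w where "x = vec3 u" "y = vec3 v" "z = vec3 w" "lines u v w"
    "in_trie u (cap_trie a)" "in_trie v (cap_trie b)" "in_trie w (cap_trie c)"
proof -
  obtain u v w where mem: "u \<in> set (cap_words a)" "v \<in> set (cap_words b)" "w \<in> set (cap_words c)"
    and eqs: "x = vec3 u" "y = vec3 v" "z = vec3 w"
    using assms(1-3) unfolding cap6_def by blast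
  then show ?thesis
    using that[of u v w] vec3_sum_eq_0[of u v w] cap_words_length in_trie_of assms(4) by simp
qed

lemma extendable_cap6: "extendable cap6"
proof -
  have "line_free (cap_trie c)" for c
    using line_free_cap_words by (cases c) simp_all
  then have "cap_set (cap6 c)" for c
    unfolding cap_set_def by (metis cap6_sum_zeroE line_free)
  moreover have "x + y + z \<noteq> 0" if "line_free3 (cap_trie a) (cap_trie b) (cap_trie c)"
    "x \<in> cap6 a" "y \<in> cap6 b" "z \<in> cap6 c" for a b c x y z
    using line_free3[OF that(1)] that(2-4) by (metis cap6_sum_zeroE)
  ultimately show ?thesis
    unfolding extendable_def using line_free_cap_words by blast
qed

section \<open>The 330 words of length 11\<close>

text \<open>
  An admissible set with exactly one word for each 7-subset of the 11 coordinates as support. It was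
  found with a SAT solver, after imposing invariance under the 55 maps \<open>k \<mapsto> a * k + b\<close> of
  \<open>\<int>/11\<close> with \<open>a\<close> a nonzero square; the six words represent the six orbits, and \<open>dilate\<close> is the
  action of the generator 3 of the squares.
\<close>

definition base_words :: "trit list list" where
  "base_words = [
  [T0, T0, T0, T0, T1, T2, T1, T2, T2, T2, T1],
  [T0, T0, T0, T1, T1, T1, T0, T1, T1, T2, T1],
  [T0, T0, T0, T1, T2, T1, T1, T2, T0, T2, T2],
  [T0, T0, T0, T2, T0, T2, T1, T1, T1, T2, T2],
  [T0, T0, T0, T2, T2, T0, T2, T1, T1, T1, T2],
  [T0, T0, T1, T0, T0, T2, T1, T2, T2, T1, T2]]"

definition dilate :: "'a list \<Rightarrow> 'a list" where
  "dilate w = map ((!) w) [0, 3, 6, 9, 1, 4, 7, 10, 2, 5, 8]"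

text \<open>The range of \<open>j\<close> reflects that 3 has order 5 modulo 11.\<close>

definition words11 :: "trit list list" where
  "words11 = [rotate i ((dilate ^^ j) w). w \<leftarrow> base_words, j \<leftarrow> [0..<5], i \<leftarrow> [0..<11]]"

lemma length_words11: "length words11 = 330"
  by code_simp

lemma distinct_words11: "distinct words11"
  by code_simp

lemma words11_weight:
  "\<forall>w\<in>set words11. length w = 11 \<and> count_list w T0 = 4 \<and> length (filter (\<lambda>c. c \<noteq> T0) w) = 7"
  by code_simp

lemma separated_words11: "separated1 (trie_of 11 words11)"
  by code_simp

definition words11_vecs :: "(trit ^ 11) set" where
  "words11_vecs = vec_of_list ` set words11"

lemma admissible_words11: "admissible words11_vecs"
  unfolding admissible_def words11_vecs_def
proof clarify
  fix x y z
  assume mem: "x \<in> set words11" "y \<in> set words11" "z \<in> set words11"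
    and ne: "\<not> ((vec_of_list x :: trit ^ 11) = vec_of_list y \<and> (vec_of_list y :: trit ^ 11) = vec_of_list z)"
  have "separated x y z"
    using separated1[OF separated_words11] mem ne words11_weight in_trie_of by blast
  then have "\<exists>i < CARD(11). separating (x ! i) (y ! i) (z ! i)"
    using separated_nth mem(1) words11_weight by fastforce
  then show "\<exists>k. separating ((vec_of_list x :: trit ^ 11) $ k) (vec_of_list y $ k) (vec_of_list z $ k)"
    using all_vec_of_list[where 'n = 11, of "\<lambda>i. \<not> separating (x ! i) (y ! i) (z ! i)"]
    by (auto simp: vec_of_list_def)
qed

lemma prod_list_trit:
  fixes f :: "trit \<Rightarrow> nat"
  assumes "f T1 = m" "f T2 = m"
  shows "prod_list (map f w) = f T0 ^ count_list w T0 * m ^ length (filter (\<lambda>c. c \<noteq> T0) w)"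
proof (induction w)
  case (Cons c w)
  then show ?case using assms by (cases c) auto
qed simp

text \<open>Every word has four zeros and seven nonzero entries, so all summands of
  \<open>card_ext_prod\<close> agree.\<close>

lemma card_words11:
  fixes A :: "trit \<Rightarrow> 'a::{ab_group_add, finite} set"
  assumes "extendable A" "\<And>x::'a. x + x + x = 0" "card (A T1) = m" "card (A T2) = m"
  shows "card (ext_prod A words11_vecs) = 330 * (card (A T0) ^ 4 * m ^ 7)"
proof -
  have inj: "inj_on (vec_of_list :: _ \<Rightarrow> trit ^ 11) (set words11)"
    using words11_weight by (auto intro!: inj_onI simp: vec_of_list_eq_iff)
  have "(\<Prod>k\<in>UNIV. card (A ((vec_of_list w :: trit ^ 11) $ k))) = card (A T0) ^ 4 * m ^ 7"
    if "w \<in> set words11" for w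
    using that words11_weight
    by (simp add: prod_vec_of_list[where f = "\<lambda>c. card (A c)"] prod_list_trit[OF assms(3,4)])
  moreover have "card (set words11) = 330"
    using distinct_words11 length_words11 by (simp add: distinct_card)
  ultimately show ?thesis
    using card_ext_prod[OF assms(1) admissible_words11 _ assms(2)]
    by (simp add: words11_vecs_def sum.reindex[OF inj])
qed

section \<open>The cap in dimension 396\<close>

lemma three_eq_zero: "x + x + x = 0" for x :: 3
proof -
  have "x + x + x = 3 * x" by simp
  also have "\<dots> = 0 * x" by (rule arg_cong) simp
  finally show ?thesis by simp
qed

lemma char3_vec:
  fixes y :: "'a::ab_group_add ^ 'n"
  assumes "\<And>x :: 'a. x + x + x = 0"
  shows "y + y + y = 0"
  by (simp only: vec_eq_iff vector_add_component zero_index assms simp_thms)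

theorem theorem2p15:
  "\<exists>A :: (3 ^ 396) set. cap_set A \<and>
     card A = (11 choose 7) * 6 ^ 4 * 12 ^ 4 * 112 ^ 62"
proof -
  define B :: "trit \<Rightarrow> ((3 ^ 6) ^ 6) set" where "B c = ext_prod cap6 (one_zero_layers c)" for c
  have B: "extendable B"
    unfolding B_def using extendable_one_zero extendable_cap6 by blast
  have char3: "x + x + x = 0" for x :: "3 ^ 6"
    by (rule char3_vec) (rule three_eq_zero)
  have char3': "x + x + x = 0" for x :: "(3 ^ 6) ^ 6"
    by (rule char3_vec) (rule char3)
  have card_cap6': "card (cap6 T0) = 12" "card (cap6 T1) = 112" "card (cap6 T2) = 112"
    by (simp_all only: card_cap6 length_cap_words)
  have card_B: "card (B T0) = 6 * (12 * 112 ^ 5)" "card (B T1) = 112 ^ 6" "card (B T2) = 112 ^ 6"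
    using card_one_zero[OF extendable_cap6 char3 card_cap6'(2,3), where 'n = 6]
    unfolding B_def by (simp_all add: card_cap6'(1) del: one_zero_layers.simps)
  have choose: "(11 choose 7 :: nat) = 330"
    by code_simp
  obtain f :: "((3 ^ 6) ^ 6) ^ 11 \<Rightarrow> 3 ^ 396" where f: "inj f" "\<And>x y. f (x + y) = f x + f y"
    using ex_additive_inj[where 'k = 396 and 'l = 6 and 'm = 6 and 'n = 11 and 'a = 3] by auto
  let ?C = "ext_prod B words11_vecs"
  have "card (f ` ?C) = card ?C"
    using f(1) by (simp add: card_image inj_on_subset)
  also have "\<dots> = 330 * ((6 * (12 * 112 ^ 5)) ^ 4 * (112 ^ 6) ^ 7)"
    using card_words11[OF B char3' card_B(2,3)] by (simp only: card_B(1))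
  \<comment> \<open>The exponents of 112 add up to \<open>5 * 4 + 6 * 7 = 62\<close>.\<close>
  also have "\<dots> = (11 choose 7) * 6 ^ 4 * 12 ^ 4 * 112 ^ 62"
    unfolding choose by simp
  finally have "card (f ` ?C) = (11 choose 7) * 6 ^ 4 * 12 ^ 4 * 112 ^ 62" .
  moreover have "cap_set (f ` ?C)"
    using cap_set_image[OF cap_set_ext_prod[OF B admissible_words11] f] .
  ultimately show ?thesis by blast
qed

end
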